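(* Let $P\subset\mathbb{R}^d$ be a $d$-dimensional convex polytope containing the origin in its interior, and let $U$ be an orthogonal transformation of $\mathbb{R}^d$ with $P=UP^\circ$. Let $W$ be the orthogonal transformation of $\mathbb{R}^{d+1}$ given by the block matrix $W=\begin{pmatrix}U&0\\0&-1\end{pmatrix}$. Then there exists a pyramid $Q\subset\mathbb{R}^{d+1}$ over $P$ (i.e. $Q=\mathrm{conv}(B\cup\{p\})$, where $B$ is a polytope affinely equivalent to $P$ lying in an affine hyperplane and $p$ is a point not in that hyperplane) such that $Q=WQ^\circ$.
   Context: For $A\subseteq\mathbb{R}^m$, the polar is $A^\circ=\{x\in\mathbb{R}^m:\langle x,a\rangle\le 1\text{ for all }a\in A\}$. An orthogonal transformation is a linear map $U$ with $U^T=U^{-1}$. *)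

theory Defs
  imports "HOL-Analysis.Analysis"
begin

definition polar :: "'a::real_inner set \<Rightarrow> 'a set" where
  "polar A = {x. \<forall>a\<in>A. x \<bullet> a \<le> 1}"

text \<open>
  The two sets may lie in spaces of different dimension, so the affine map is only required to be
  a bijection between the sets, not between the ambient spaces.
\<close>
definition affinely_equivalent ::
    "'a::euclidean_space set \<Rightarrow> 'b::euclidean_space set \<Rightarrow> bool" where
  "affinely_equivalent A B \<longleftrightarrow>
     (\<exists>L c. linear L \<and> bij_betw (\<lambda>x. L x + c) A B)"

definition affine_hyperplane :: "'a::euclidean_space set \<Rightarrow> bool" where
  "affine_hyperplane H \<longleftrightarrow> (\<exists>a b. a \<noteq> 0 \<and> H = {x. a \<bullet> x = b})"

definition pyramid_over ::
    "'b::euclidean_space set \<Rightarrow> 'a::euclidean_space set \<Rightarrow> bool" where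
  "pyramid_over Q P \<longleftrightarrow>
     (\<exists>B p H. polytope B \<and> affinely_equivalent P B \<and>
        affine_hyperplane H \<and> B \<subseteq> H \<and> p \<notin> H \<and> Q = convex hull (B \<union> {p}))"

text \<open>
  With \<open>d = CARD('n)\<close>, the space \<open>\<real>\<^sup>d\<^sup>+\<^sup>1\<close> is the Euclidean space \<open>(real ^ 'n) \<times> real\<close>, whose
  inner product is \<open>(x, s) \<bullet> (y, t) = x \<bullet> y + s * t\<close>. In this decomposition the map below has
  the block matrix with diagonal blocks \<open>U\<close> and \<open>-1\<close> and zero off-diagonal blocks.
\<close>
definition block_neg :: "(real ^ 'n \<Rightarrow> real ^ 'n) \<Rightarrow> (real ^ 'n) \<times> real \<Rightarrow> (real ^ 'n) \<times> real" where
  "block_neg U = (\<lambda>(x, t). (U x, - t))"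

lemma DIM_extended: "DIM((real ^ 'n) \<times> real) = CARD('n) + 1"
  by simp

lemma orthogonal_transformation_block_neg:
  assumes "orthogonal_transformation U"
  shows "orthogonal_transformation (block_neg U)"
proof -
  have U: "linear U" "\<And>v w. U v \<bullet> U w = v \<bullet> w"
    using assms by (auto simp: orthogonal_transformation_def)
  have "linear (block_neg U)"
    by (rule linearI) (auto simp: block_neg_def linear_add[OF U(1)] linear_scale[OF U(1)])
  then show ?thesis
    by (auto simp: orthogonal_transformation_def block_neg_def U(2))
qed

end

theory Submission
  imports Defs
begin

text \<open>
  Take the apex \<open>(0, 1)\<close> and the base \<open>\<surd>2 P\<close> at height \<open>-1\<close>. The slice of the pyramid at height
  \<open>t \<in> [-1, 1]\<close> is \<open>((1 - t) / \<surd>2) P\<close>, and that of its polar is \<open>((1 + t) / \<surd>2) polar P\<close>.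
  Reflecting the height and applying \<open>U\<close> to the slices exchanges the two descriptions. The factor
  \<open>\<surd>2\<close> is forced by the slice ratios \<open>r / 2\<close> and \<open>1 / r\<close> arising from a base \<open>r P\<close>.
\<close>

text \<open>For fixed \<open>x\<close> the constraint on \<open>y\<close> defines a half-space,
  which is convex and so contains the hull of any set it contains. Hence the polar of the pyramid
  need only be tested on its base and apex.\<close>

lemma polar_convex_hull: "polar (convex hull S) = polar S"
proof
  show "polar (convex hull S) \<subseteq> polar S"
    by (auto simp: polar_def hull_inc)
  show "polar S \<subseteq> polar (convex hull S)"
  proof
    fix x assume "x \<in> polar S"
    then have "convex hull S \<subseteq> {y. x \<bullet> y \<le> 1}"
      by (intro hull_minimal convex_halfspace_le) (auto simp: polar_def)
    then show "x \<in> polar (convex hull S)"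
      by (auto simp: polar_def)
  qed
qed

lemma interior_nonpos_inner_imp_zero:
  fixes y :: "'a::real_inner"
  assumes "0 \<in> interior P" and le: "\<And>x. x \<in> P \<Longrightarrow> y \<bullet> x \<le> 0"
  shows "y = 0"
proof -
  obtain e where e: "e > 0" "cball 0 e \<subseteq> P"
    using assms(1) mem_interior_cball by blast
  \<comment> \<open>A multiple of \<open>y\<close> of norm \<open>e\<close>, pairing positively with
    \<open>y\<close> unless \<open>y = 0\<close>. For \<open>y = 0\<close> division by zero yields
    0, so membership still holds.\<close>
  have "(e / norm y) *\<^sub>R y \<in> P"
    using e by (intro subsetD[OF e(2)]) auto
  from le[OF this] have "(e / norm y) * (y \<bullet> y) \<le> 0"
    by simp
  moreover have "y \<noteq> 0 \<Longrightarrow> (e / norm y) * (y \<bullet> y) > 0"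
    using e(1) by simp
  ultimately show "y = 0"
    by linarith
qed

definition pyramid_base :: "'a::real_normed_vector set \<Rightarrow> ('a \<times> real) set" where
  "pyramid_base P = (\<lambda>x. (sqrt 2 *\<^sub>R x, -1)) ` P"

definition self_polar_pyramid :: "'a::real_normed_vector set \<Rightarrow> ('a \<times> real) set" where
  "self_polar_pyramid P = convex hull (pyramid_base P \<union> {(0, 1)})"

text \<open>Splitting off the translation lets polytopality and convexity pass through the linear
  part first.\<close>

lemma pyramid_base_eq_translation:
  "pyramid_base P = (+) (0, -1) ` (\<lambda>x. (sqrt 2 *\<^sub>R x, 0)) ` P"
  by (simp add: pyramid_base_def image_image)

lemma linear_scale_embed: "linear (\<lambda>x::'a::real_vector. (c *\<^sub>R x, 0::real))"
  by (rule linearI) (auto simp: scaleR_add_right)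

lemma polytope_pyramid_base:
  fixes P :: "'a::euclidean_space set"
  assumes "polytope P"
  shows "polytope (pyramid_base P)"
  using polytope_linear_image[OF linear_scale_embed assms]
  by (simp add: pyramid_base_eq_translation polytope_translation_eq)

lemma pyramid_over_self_polar_pyramid:
  fixes P :: "'a::euclidean_space set"
  assumes "polytope P"
  shows "pyramid_over (self_polar_pyramid P) P"
proof -
  have "affinely_equivalent P (pyramid_base P)"
    unfolding affinely_equivalent_def pyramid_base_def
    using linear_scale_embed[of "sqrt 2"]
    by (intro exI[of _ "\<lambda>x. (sqrt 2 *\<^sub>R x, 0)"] exI[of _ "(0, -1)"])
       (auto intro!: inj_on_imp_bij_betw inj_onI)
  moreover have "affine_hyperplane {z :: 'a \<times> real. (0, 1) \<bullet> z = -1}"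
    unfolding affine_hyperplane_def by (intro exI[of _ "(0, 1)"] exI[of _ "-1"]) (auto simp: zero_prod_def)
  moreover have "pyramid_base P \<subseteq> {z. (0, 1) \<bullet> z = -1}"
    by (auto simp: pyramid_base_def)
  moreover have "(0, 1) \<notin> {z :: 'a \<times> real. (0, 1) \<bullet> z = -1}"
    by auto
  ultimately show ?thesis
    using polytope_pyramid_base[OF assms]
    unfolding pyramid_over_def self_polar_pyramid_def by blast
qed

text \<open>A point of the pyramid is \<open>u\<close> times the apex plus \<open>v\<close> times
  one base point. The height \<open>t = u - v\<close> together with \<open>u + v = 1\<close> forces
  \<open>v = (1 - t) / 2\<close>, and the base contributes the factor \<open>sqrt 2\<close>.\<close>

lemma mem_self_polar_pyramid_iff:
  fixes P :: "'a::euclidean_space set"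
  assumes "convex P" "P \<noteq> {}"
  shows "(x, t) \<in> self_polar_pyramid P \<longleftrightarrow>
    -1 \<le> t \<and> t \<le> 1 \<and> (\<exists>y\<in>P. x = ((1 - t) / sqrt 2) *\<^sub>R y)"
proof -
  have conv: "convex hull (pyramid_base P) = pyramid_base P"
    using convex_linear_image[OF linear_scale_embed assms(1)]
    by (simp add: pyramid_base_eq_translation convex_hull_eq convex_translation)
  have ne: "pyramid_base P \<noteq> {}"
    using assms(2) by (simp add: pyramid_base_def)
  have "(x, t) \<in> self_polar_pyramid P \<longleftrightarrow>
      (\<exists>u\<ge>0. \<exists>v\<ge>0. u + v = 1 \<and> (\<exists>y\<in>P. x = (v * sqrt 2) *\<^sub>R y \<and> t = u - v))"
    \<comment> \<open>Since the base is its own hull, a single base point suffices in each convex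
      combination.\<close>
    unfolding self_polar_pyramid_def Un_insert_right Un_empty_right convex_hull_insert[OF ne] conv
    by (fastforce simp: pyramid_base_def)
  also have "\<dots> \<longleftrightarrow> -1 \<le> t \<and> t \<le> 1 \<and> (\<exists>y\<in>P. x = (((1 - t) / 2) * sqrt 2) *\<^sub>R y)"
    (is "?A \<longleftrightarrow> ?B")
  proof
    assume ?A
    then obtain u v y where uv: "u \<ge> 0" "v \<ge> 0" "u + v = 1" "t = u - v"
      and y: "y \<in> P" "x = (v * sqrt 2) *\<^sub>R y"
      by blast
    from uv have "v = (1 - t) / 2" "-1 \<le> t" "t \<le> 1"
      by auto
    with y show ?B
      by blast
  next
    assume ?B
    then show ?A
      by (intro exI[of _ "(1 + t) / 2"] exI[of _ "(1 - t) / 2"] conjI)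
         (auto simp: field_simps)
  qed
  also have "((1 - t) / 2) * sqrt 2 = (1 - t) / sqrt 2"
    by (simp add: field_simps)
  finally show ?thesis .
qed

text \<open>The apex gives the bound on \<open>s\<close>; the base points give the remaining
  inequalities.\<close>

lemma mem_polar_self_polar_pyramid_iff:
  "(y, s) \<in> polar (self_polar_pyramid P) \<longleftrightarrow> s \<le> 1 \<and> (\<forall>x\<in>P. sqrt 2 * (y \<bullet> x) \<le> 1 + s)"
  unfolding self_polar_pyramid_def polar_convex_hull
  by (auto simp: polar_def pyramid_base_def algebra_simps)

text \<open>For \<open>s > -1\<close>, dividing the base inequalities by \<open>1 + s\<close> turns
  them into membership in \<open>polar P\<close>. The interior hypothesis gives
  \<open>-1 \<le> s\<close> and handles \<open>s = -1\<close>, where division fails.\<close>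

lemma mem_polar_self_polar_pyramid_iff_slice:
  fixes P :: "'a::real_inner set"
  assumes "0 \<in> interior P"
  shows "(y, s) \<in> polar (self_polar_pyramid P) \<longleftrightarrow>
    -1 \<le> s \<and> s \<le> 1 \<and> (\<exists>z\<in>polar P. y = ((1 + s) / sqrt 2) *\<^sub>R z)"
    (is "?L \<longleftrightarrow> ?R")
proof
  assume L: ?L
  then have s: "s \<le> 1" and le: "\<And>x. x \<in> P \<Longrightarrow> sqrt 2 * (y \<bullet> x) \<le> 1 + s"
    by (auto simp: mem_polar_self_polar_pyramid_iff)
  have "0 \<in> P"
    using assms interior_subset by blast
  from le[OF this] have s': "-1 \<le> s"
    by simp
  have "\<exists>z\<in>polar P. y = ((1 + s) / sqrt 2) *\<^sub>R z"
  proof (cases "s = -1")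
    case True
    \<comment> \<open>At \<open>s = -1\<close> the base inequalities say that \<open>y\<close> pairs
      nonpositively with all of \<open>P\<close>.\<close>
    have "y = 0"
      using assms
    proof (rule interior_nonpos_inner_imp_zero)
      show "y \<bullet> x \<le> 0" if "x \<in> P" for x
        using le[OF that] True by (simp add: mult_le_0_iff)
    qed
    then show ?thesis
      using True by (intro bexI[of _ 0]) (auto simp: polar_def)
  next
    case False
    with s' have "1 + s > 0"
      by simp
    then have "(sqrt 2 / (1 + s)) *\<^sub>R y \<in> polar P"
      using le by (auto simp: polar_def field_simps)
    then show ?thesis
      using \<open>1 + s > 0\<close> by (intro bexI[of _ "(sqrt 2 / (1 + s)) *\<^sub>R y"]) auto
  qed
  with s s' show ?R
    by blast
next
  assume ?R
  then obtain z where z: "z \<in> polar P" "y = ((1 + s) / sqrt 2) *\<^sub>R z" and s: "-1 \<le> s" "s \<le> 1"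
    by blast
  have "sqrt 2 * (y \<bullet> x) \<le> 1 + s" if "x \<in> P" for x
  proof -
    have "sqrt 2 * (y \<bullet> x) = (1 + s) * (z \<bullet> x)"
      by (simp add: z(2))
    also have "\<dots> \<le> (1 + s) * 1"
      using z(1) that s by (intro mult_left_mono) (auto simp: polar_def)
    finally show ?thesis
      by simp
  qed
  with s show ?L
    by (simp add: mem_polar_self_polar_pyramid_iff)
qed

theorem theorem5p1:
  fixes P :: "(real ^ 'n) set"
    and U :: "real ^ 'n \<Rightarrow> real ^ 'n"
    and W :: "(real ^ 'n) \<times> real \<Rightarrow> (real ^ 'n) \<times> real"
  assumes "polytope P"
    and "aff_dim P = int CARD('n)"
    and "0 \<in> interior P"
    and "orthogonal_transformation U"
    and "P = U ` polar P"
    and "W = block_neg U"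
  shows "\<exists>Q :: ((real ^ 'n) \<times> real) set. pyramid_over Q P \<and> Q = W ` polar Q"
proof (intro exI conjI)
  show "pyramid_over (self_polar_pyramid P) P"
    by (rule pyramid_over_self_polar_pyramid[OF assms(1)])
  have ne: "P \<noteq> {}"
    using assms(3) by auto
  have U: "U (c *\<^sub>R x) = c *\<^sub>R U x" for c x
    using assms(4) by (simp add: orthogonal_transformation_def linear_scale)
  note Q = mem_self_polar_pyramid_iff[OF polytope_imp_convex[OF assms(1)] ne]
  note Q' = mem_polar_self_polar_pyramid_iff_slice[OF assms(3)]
  show "self_polar_pyramid P = W ` polar (self_polar_pyramid P)"
  proof (intro equalityI subsetI)
    fix w assume "w \<in> self_polar_pyramid P"
    moreover obtain x t where w: "w = (x, t)"
      by fastforce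
    ultimately obtain y where t: "-1 \<le> t" "t \<le> 1" and y: "y \<in> P" "x = ((1 - t) / sqrt 2) *\<^sub>R y"
      using Q by blast
    obtain z where z: "z \<in> polar P" "y = U z"
      using y(1) assms(5) by blast
    \<comment> \<open>At height \<open>-t\<close> the polar slice has factor
      \<open>1 + (-t)\<close>, exactly that of the pyramid at height \<open>t\<close>; linearity
      lets \<open>U\<close> pass through it.\<close>
    have "(((1 - t) / sqrt 2) *\<^sub>R z, - t) \<in> polar (self_polar_pyramid P)"
      using t z(1) by (auto simp: Q')
    moreover have "w = W (((1 - t) / sqrt 2) *\<^sub>R z, - t)"
      by (simp add: assms(6) block_neg_def U w y(2) z(2))
    ultimately show "w \<in> W ` polar (self_polar_pyramid P)"
      by blast
  next
    fix w assume "w \<in> W ` polar (self_polar_pyramid P)"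
    then obtain y s where w: "w = W (y, s)" "(y, s) \<in> polar (self_polar_pyramid P)"
      by auto
    then obtain z where s: "-1 \<le> s" "s \<le> 1" and z: "z \<in> polar P" "y = ((1 + s) / sqrt 2) *\<^sub>R z"
      using Q' by blast
    have "U z \<in> P"
      using z(1) assms(5) by blast
    then have "(((1 + s) / sqrt 2) *\<^sub>R U z, - s) \<in> self_polar_pyramid P"
      using s by (auto simp: Q)
    then show "w \<in> self_polar_pyramid P"
      by (simp add: assms(6) block_neg_def U w(1) z(2))
  qed
qed

end
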